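(* Let $r\ge 1$ be an integer and let $G$ be a $K_{r+1}$-free graph of order $n$. Then \[\frac{\lambda_1(G)+\lambda_n(G)}{n}\le\left(2\sqrt{1-\frac{1}{r}}-1\right)^2.\]
   Context: Graphs are finite, simple and have a nonempty vertex set; the order of a graph is its number of vertices. $\lambda_1(G)\ge\lambda_2(G)\ge\cdots\ge\lambda_n(G)$ are the eigenvalues of the adjacency matrix $A(G)$ of $G$. A graph is $K_{r+1}$-free if it contains no clique on $r+1$ vertices. *)

theory Defs
  imports
    "HOL-Computational_Algebra.Polynomial"
    "Jordan_Normal_Form.Char_Poly"
    "Graph_Theory.Kuratowski"
begin

text \<open>
  Finite simple graphs are the models of the locale \<^locale>\<open>graph\<close>: finite, loop-free symmetric
  digraphs without parallel arcs, so that an edge $uv$ is the pair of arcs $(u,v)$, $(v,u)$.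
  They may have an empty vertex set; this has to be excluded separately.
\<close>

abbreviation graph_order :: "('a, 'b) pre_digraph \<Rightarrow> nat" where
  "graph_order G \<equiv> card (verts G)"

definition K_free :: "nat \<Rightarrow> ('a, 'b) pre_digraph \<Rightarrow> bool" where
  "K_free k G \<longleftrightarrow> \<not> (\<exists>H. subgraph H G \<and> K\<^bsub>k\<^esub> H)"

definition vertex_enum :: "('a, 'b) pre_digraph \<Rightarrow> 'a list \<Rightarrow> bool" where
  "vertex_enum G vs \<longleftrightarrow> distinct vs \<and> set vs = verts G"

definition adj_matrix_of :: "('a, 'b) pre_digraph \<Rightarrow> 'a list \<Rightarrow> real mat" where
  "adj_matrix_of G vs = mat (length vs) (length vs)
     (\<lambda>(i, j). if (vs ! i, vs ! j) \<in> arcs_ends G then 1 else 0)"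

text \<open>
  Matrices are indexed by natural numbers, so the adjacency matrix depends on an enumeration of
  the vertices. An arbitrary one is chosen; by \<open>char_poly_adj_matrix\<close> below the characteristic
  polynomial does not depend on the choice.
\<close>

definition adj_matrix :: "('a, 'b) pre_digraph \<Rightarrow> real mat" where
  "adj_matrix G = adj_matrix_of G (SOME vs. vertex_enum G vs)"

text \<open>
  \<open>graph_eigenvalue i G\<close> is $\lambda_i(G)$, counted from 1 with multiplicity in non-increasing
  order; it is meant for $1 \le i \le n$, where $n$ is the order of $G$. As the adjacency matrix
  is real symmetric, its characteristic polynomial has $n$ real roots with multiplicity.
\<close>

definition graph_eigenvalues :: "('a, 'b) pre_digraph \<Rightarrow> real list" where
  "graph_eigenvalues G = rev (sorted_list_of_multiset (proots (char_poly (adj_matrix G))))"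

definition graph_eigenvalue :: "nat \<Rightarrow> ('a, 'b) pre_digraph \<Rightarrow> real" where
  "graph_eigenvalue i G = graph_eigenvalues G ! (i - 1)"

lemma vertex_enum_bij:
  assumes "vertex_enum G vs" "vertex_enum G ws"
  obtains p where "bij_betw p {..<length vs} {..<length vs}"
    "\<And>i. i < length vs \<Longrightarrow> vs ! i = ws ! p i" "length ws = length vs"
proof -
  have d: "distinct vs" "distinct ws" "set vs = set ws"
    using assms by (auto simp: vertex_enum_def)
  then have len: "length ws = length vs" by (metis distinct_card)
  have bv: "bij_betw ((!) vs) {..<length vs} (set vs)"
    and bw: "bij_betw ((!) ws) {..<length vs} (set vs)"
    using d len by (auto intro: bij_betw_nth)
  define p where "p = inv_into {..<length vs} ((!) ws) \<circ> (!) vs"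
  have "bij_betw p {..<length vs} {..<length vs}"
    unfolding p_def by (rule bij_betw_trans[OF bv bij_betw_inv_into[OF bw]])
  moreover have "vs ! i = ws ! p i" if "i < length vs" for i
    using that bij_betw_inv_into_right[OF bw, of "vs ! i"] by (simp add: p_def)
  ultimately show thesis using that len by blast
qed

lemma char_poly_adj_matrix_of_unique:
  assumes "vertex_enum G vs" "vertex_enum G ws"
  shows "char_poly (adj_matrix_of G vs) = char_poly (adj_matrix_of G ws)"
proof -
  define n where "n = length vs"
  obtain p where p: "bij_betw p {..<n} {..<n}"
    and vw: "\<And>i. i < n \<Longrightarrow> vs ! i = ws ! p i" and len: "length ws = n"
    using vertex_enum_bij[OF assms] unfolding n_def by metis
  have pn: "p i < n" if "i < n" for i
    using bij_betwE[OF p] that by auto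
  have inj: "p i = p j \<longleftrightarrow> i = j" if "i < n" "j < n" for i j
    using p that by (auto simp: bij_betw_def inj_on_def)
  define A where "A = adj_matrix_of G ws"
  define P where "P = mat n n (\<lambda>(i, j). if j = p i then 1 else 0 :: real)"
  have carr: "P \<in> carrier_mat n n" "P\<^sup>T \<in> carrier_mat n n" "A \<in> carrier_mat n n"
    "adj_matrix_of G vs \<in> carrier_mat n n"
    by (auto simp: P_def A_def adj_matrix_of_def len n_def)
  have PPT: "P * P\<^sup>T = 1\<^sub>m n"
    by (rule eq_matI)
      (auto simp: P_def scalar_prod_def if_distrib[of "\<lambda>x. x * _"] sum.delta' pn inj cong: if_cong)
  have PTP: "P\<^sup>T * P = 1\<^sub>m n"
    using mat_mult_left_right_inverse[OF carr(1,2) PPT] .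
  have PA: "P * A = mat n n (\<lambda>(i, j). A $$ (p i, j))"
    using carr by (intro eq_matI)
      (auto simp: P_def scalar_prod_def if_distrib[of "\<lambda>x. x * _"] pn cong: if_cong)
  have "adj_matrix_of G vs = P * A * P\<^sup>T"
    unfolding PA using carr by (intro eq_matI)
      (auto simp: P_def scalar_prod_def if_distrib[of "\<lambda>x. _ * x"] pn
        A_def adj_matrix_of_def len vw n_def[symmetric] cong: if_cong)
  then have "similar_mat (adj_matrix_of G vs) A"
    using carr PPT PTP by (intro similar_matI[of _ _ P "P\<^sup>T" n]) auto
  then show ?thesis unfolding A_def by (rule char_poly_similar)
qed

lemma char_poly_adj_matrix:
  assumes "vertex_enum G vs"
  shows "char_poly (adj_matrix G) = char_poly (adj_matrix_of G vs)"
  unfolding adj_matrix_def using assms by (intro char_poly_adj_matrix_of_unique) (rule someI)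

end

theory Submission
  imports Defs "HOL-Analysis.Function_Topology"
begin

text \<open>
  Let $\mu$ be the largest eigenvalue, let $L > 0$ be such that $A + LI$ is positive semidefinite,
  and let $x$ be a unit eigenvector for $\mu$. Evaluating the form $A + LI$ at the indicator of the
  neighbourhood $N(v)$, which has inner product $\mu x_v$ with $x$, and summing over $v$ gives
  $\mu^2 (\mu + L) \le \sum_v (2 e(N(v)) + L d_v)$. As $N(v)$ induces a $K_r$-free graph whose
  adjacency form is again at least $-L$, the edges in $N(v)$ can be bounded by induction on $r$.

  With $P_r(t) = 1 + t + \dots + t^{r-1}$, the optimal bound obtained this way says that
  $(n, \mu + L)$ lies below the curve $t \mapsto (L t P_r(t), L P_r(t))$. For the induction
  the bound is kept in the equivalent form of all the tangents to this curve: these are linear in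
  $n$ and therefore can be summed over the neighbourhoods, even when $G$ is not regular.
  Choosing finally $t$ with $n = L t P_r(t)$, one has $\mu - L \le L (P_r(t) - 2)$, and the claim
  reduces to the inequality $(r - (r - 2) t) P_r(t) \le r (1 + t)$.
\<close>

section \<open>Geometric sums\<close>

text \<open>\<open>dgeom r\<close> is the derivative of \<open>geom r\<close>; only its product-rule recursion is needed.\<close>

primrec geom :: "nat \<Rightarrow> real \<Rightarrow> real" where
  "geom 0 t = 0"
| "geom (Suc r) t = 1 + t * geom r t"

primrec dgeom :: "nat \<Rightarrow> real \<Rightarrow> real" where
  "dgeom 0 t = 0"
| "dgeom (Suc r) t = geom r t + t * dgeom r t"

lemma geom_nonneg: "t \<ge> 0 \<Longrightarrow> geom r t \<ge> 0"
  by (induction r) auto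

lemma dgeom_nonneg: "t \<ge> 0 \<Longrightarrow> dgeom r t \<ge> 0"
  by (induction r) (auto simp: geom_nonneg)

lemma geom_Suc_ge_1: "t \<ge> 0 \<Longrightarrow> geom (Suc r) t \<ge> 1"
  by (simp add: geom_nonneg)

lemma geom_Suc_right: "geom (Suc r) t = geom r t + t ^ r"
  by (induction r) (auto simp: algebra_simps)

lemma continuous_on_geom: "continuous_on A (geom r)"
proof (induction r)
  case 0
  show ?case by (simp add: continuous_on_const)
next
  case (Suc r)
  then show ?case by (auto intro!: continuous_intros)
qed

lemma dgeom_mono: "t \<ge> 0 \<Longrightarrow> dgeom r t \<le> dgeom (Suc r) t"
proof (induction r)
  case (Suc r)
  have "geom r t \<le> geom (Suc r) t"
    using Suc.prems by (simp only: geom_Suc_right) simp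
  then show ?case
    using Suc.IH[OF Suc.prems] Suc.prems
    by (auto simp only: dgeom.simps(2)[of "Suc r"] dgeom.simps(2)[of r] intro!: add_mono mult_left_mono)
qed auto

text \<open>For j < r the coefficient of t^j is j + 1 on both sides, and the square has further
  nonnegative terms. This makes the gap in \<open>tangent_step\<close> nonnegative.\<close>

lemma dgeom_Suc_le_square: "t \<ge> 0 \<Longrightarrow> dgeom (Suc r) t \<le> (geom r t)\<^sup>2"
proof (induction r)
  case (Suc r)
  have "dgeom r t \<le> (geom r t)\<^sup>2"
    using Suc dgeom_mono[of t r] by linarith
  then have "t\<^sup>2 * dgeom r t \<le> t\<^sup>2 * (geom r t)\<^sup>2"
    by (intro mult_left_mono) auto
  then show ?case
    by (simp add: power2_eq_square algebra_simps)
qed auto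

text \<open>This is AM-GM for the number 1 and \<open>r\<close> copies of \<open>t ^ Suc r\<close>.
  In the induction the gap between the two sides grows by (r + 1) * t^r * (1 - t)^2.\<close>

lemma weighted_power_ineq:
  fixes t :: real
  assumes "t \<ge> 0"
  shows "real (Suc r) * t ^ r \<le> 1 + real r * t ^ Suc r"
proof (induction r)
  case (Suc r)
  have "real (Suc r) * t ^ r * (1 - t)\<^sup>2 \<ge> 0"
    using assms by simp
  then show ?case
    using Suc by (simp add: power2_eq_square algebra_simps)
qed auto

text \<open>The first factor is 2 + (r - 1) * (1 - t), and (1 - t) times the geometric sum
  telescopes. What remains is an upper bound for \<open>2 * t * geom r t\<close> with equality at t
  = 1; its induction step is t times \<open>weighted_power_ineq\<close>.\<close>

lemma geom_le:
  fixes t :: real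
  assumes "t \<ge> 0"
  shows "(real (Suc r) - (real (Suc r) - 2) * t) * geom (Suc r) t \<le> real (Suc r) * (1 + t)"
proof -
  have tel: "(1 - t) * geom k t = 1 - t ^ k" for k
    using geom_Suc_right[of k t] by (simp add: algebra_simps)
  have "2 * t * geom r t \<le> real (Suc r) * t + (real r - 1) * t ^ Suc r"
  proof (induction r)
    case (Suc r)
    have "t * (real (Suc r) * t ^ r) \<le> t * (1 + real r * t ^ Suc r)"
      using weighted_power_ineq[OF assms, of r] assms by (intro mult_left_mono)
    moreover have "2 * t * geom (Suc r) t = 2 * t * geom r t + 2 * t * t ^ r"
      by (simp only: geom_Suc_right distrib_left)
    ultimately show ?case
      using Suc by (simp add: algebra_simps)
  qed auto
  moreover have "(real (Suc r) - (real (Suc r) - 2) * t) * geom (Suc r) t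
      = 2 * geom (Suc r) t + (real r - 1) * ((1 - t) * geom (Suc r) t)"
    by (simp add: algebra_simps del: geom.simps)
  ultimately show ?thesis
    unfolding tel by (simp add: algebra_simps)
qed

text \<open>The geometric sum is at least 1, so the continuous function on the left is 0 at 0 and at
  least c at c.\<close>

lemma geom_Suc_surj:
  fixes c :: real
  assumes "c \<ge> 0"
  obtains t where "t \<ge> 0" "t * geom (Suc r) t = c"
proof -
  have "c * 1 \<le> c * geom (Suc r) c"
    using assms geom_Suc_ge_1[of c r] by (intro mult_left_mono)
  then have "\<exists>t. 0 \<le> t \<and> t \<le> c \<and> t * geom (Suc r) t = c"
    using assms by (intro IVT' continuous_intros continuous_on_geom) auto
  then show thesis using that by blast
qed

text \<open>Dividing \<open>geom_le\<close> by \<open>Suc r\<close> turns its coefficient into 2 *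
  s^2 - 1. Twice the result, combined with the nonnegative square P * (1 - (2 * s - 1) * t)^2, is
  the claim multiplied by 1 + t.\<close>

lemma geom_minus_2_le:
  fixes t :: real
  assumes "t \<ge> 0"
  shows "geom (Suc r) t - 2 \<le> (2 * sqrt (1 - 1 / real (Suc r)) - 1)\<^sup>2 * (t * geom (Suc r) t)"
proof -
  define s where "s = sqrt (1 - 1 / real (Suc r))"
  define P where "P = geom (Suc r) t"
  have s2: "s\<^sup>2 = 1 - 1 / real (Suc r)"
    unfolding s_def by simp
  have P: "P \<ge> 1"
    using geom_Suc_ge_1[OF assms] by (simp add: P_def)
  have "(1 - (2 * s\<^sup>2 - 1) * t) * P \<le> 1 + t"
  proof -
    have "real (Suc r) * ((1 - (2 * s\<^sup>2 - 1) * t) * P)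
        = (real (Suc r) - (real (Suc r) - 2) * t) * P"
      unfolding s2 by (simp add: field_simps)
    also have "\<dots> \<le> real (Suc r) * (1 + t)"
      using geom_le[OF assms, of r] by (simp only: P_def)
    finally show ?thesis
      by (simp del: of_nat_Suc)
  qed
  \<comment> \<open>AM-GM: \<open>4 * s\<^sup>2 * t \<le> (1 + t) * (1 + (2 * s - 1)\<^sup>2 * t)\<close>\<close>
  moreover have "P * (1 - (2 * s - 1) * t)\<^sup>2 \<ge> 0"
    using P by simp
  ultimately have "(P - 2) * (1 + t) \<le> (2 * s - 1)\<^sup>2 * (t * P) * (1 + t)"
    by (simp add: power2_eq_square algebra_simps)
  then have "P - 2 \<le> (2 * s - 1)\<^sup>2 * (t * P)"
    using assms by (simp add: mult_le_cancel_right)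
  then show ?thesis
    by (simp only: s_def P_def)
qed

text \<open>
  The induction step from \<open>Q\<close> to \<open>P = 1 + t * Q\<close>. Tangency at \<open>\<mu> = t * Q * L\<close> makes the gap,
  after clearing denominators, the square \<open>(Q\<^sup>2 - Q') * (\<mu> - t * Q * L)\<^sup>2\<close>.
\<close>

lemma tangent_step:
  fixes L t \<mu> n :: real and r :: nat
  assumes "L > 0" "t \<ge> 0" "\<mu> \<ge> 0" "n \<ge> 0"
  defines "P \<equiv> geom (Suc (Suc r)) t" and "P' \<equiv> dgeom (Suc (Suc r)) t"
    and "Q \<equiv> geom (Suc r) t" and "Q' \<equiv> dgeom (Suc r) t"
  assumes le: "(Q + t * Q') * (\<mu> + L) * \<mu>\<^sup>2 \<le> n * \<mu> * (Q' * \<mu> + Q\<^sup>2 * L)"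
  shows "(P + t * P') * (\<mu> + L) \<le> P' * n + P\<^sup>2 * L"
proof -
  have P: "P = 1 + t * Q" and P': "P' = Q + t * Q'"
    by (simp_all add: P_def P'_def Q_def Q'_def)
  have Q: "Q \<ge> 1" and Q': "Q' \<ge> 0"
    using assms geom_Suc_ge_1 dgeom_nonneg by (auto simp only: Q_def Q'_def)
  have QQ: "Q\<^sup>2 - Q' \<ge> 0"
    using dgeom_Suc_le_square[of t "Suc r"] dgeom_mono[of t "Suc r"] assms(2)
    unfolding Q_def Q'_def by linarith
  have P'0: "P' \<ge> 0"
    using P' Q Q' assms(2) by simp
  show ?thesis
  proof (cases "\<mu> = 0")
    case True
    \<comment> \<open>Here \<open>le\<close> degenerates to 0 \<le> 0, but P^2 - P - t * P' = t^2 *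
      (Q^2 - Q') already gives the claim.\<close>
    have "t\<^sup>2 * (Q\<^sup>2 - Q') * L \<ge> 0"
      using QQ assms by simp
    moreover have "P' * n \<ge> 0"
      using P'0 assms by simp
    ultimately show ?thesis
      unfolding True P by (simp add: P' power2_eq_square algebra_simps)
  next
    case False
    then have mu: "\<mu> > 0" using assms by simp
    define D where "D = Q' * \<mu> + Q\<^sup>2 * L"
    have D: "D > 0"
    proof -
      have "Q\<^sup>2 * L > 0" using Q assms by simp
      then show ?thesis using Q' mu by (simp add: D_def add_nonneg_pos)
    qed
    have "\<mu> * (P' * (\<mu> + L) * \<mu>) \<le> \<mu> * (n * D)"
      using le unfolding P' D_def by (simp add: power2_eq_square algebra_simps)
    then have "P' * (\<mu> + L) * \<mu> \<le> n * D"
      using mu by simp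
    then have "P' * (P' * (\<mu> + L) * \<mu>) \<le> P' * (n * D)"
      using P'0 by (rule mult_left_mono)
    moreover have "(Q\<^sup>2 - Q') * (\<mu> - t * Q * L)\<^sup>2 \<ge> 0"
      using QQ by simp
    ultimately have "((P + t * P') * (\<mu> + L) - P\<^sup>2 * L) * D \<le> P' * n * D"
      unfolding P P' D_def by (simp add: power2_eq_square algebra_simps)
    then show ?thesis
      using D by (simp add: mult_le_cancel_right)
  qed
qed

section \<open>Quadratic forms on finite sets\<close>

text \<open>The matrix is a function on vertices, so that passing to a neighbourhood only shrinks
  \<open>V\<close> and keeps \<open>a\<close>.\<close>

definition bil :: "'a set \<Rightarrow> ('a \<Rightarrow> 'a \<Rightarrow> real) \<Rightarrow> ('a \<Rightarrow> real) \<Rightarrow> ('a \<Rightarrow> real) \<Rightarrow> real" where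
  "bil V a x y = (\<Sum>u\<in>V. \<Sum>v\<in>V. a u v * x u * y v)"

lemma bil_eq: "bil V a x y = (\<Sum>u\<in>V. x u * (\<Sum>v\<in>V. a u v * y v))"
  unfolding bil_def by (intro sum.cong) (auto simp: sum_distrib_left mult_ac)

lemma bil_scaleR: "bil V a (\<lambda>v. c * x v) (\<lambda>v. d * y v) = c * d * bil V a x y"
  unfolding bil_def sum_distrib_left by (intro sum.cong) (auto simp: mult_ac)

lemma bil_commute:
  assumes "\<And>u v. u \<in> V \<Longrightarrow> v \<in> V \<Longrightarrow> a u v = a v u"
  shows "bil V a x y = bil V a y x"
  unfolding bil_def by (subst sum.swap, intro sum.cong) (auto simp: assms mult_ac)

lemma bil_add_square:
  assumes "\<And>u v. u \<in> V \<Longrightarrow> v \<in> V \<Longrightarrow> a u v = a v u"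
  shows "bil V a (\<lambda>v. x v + s * y v) (\<lambda>v. x v + s * y v)
    = bil V a x x + 2 * s * bil V a y x + s\<^sup>2 * bil V a y y"
proof -
  have "bil V a x y = bil V a y x"
    by (rule bil_commute[OF assms])
  moreover have "bil V a (\<lambda>v. x v + s * y v) (\<lambda>v. x v + s * y v)
    = bil V a x x + s * bil V a x y + s * bil V a y x + s\<^sup>2 * bil V a y y"
    unfolding bil_def
    by (simp add: sum.distrib sum_distrib_left algebra_simps power2_eq_square)
  ultimately show ?thesis by simp
qed

section \<open>Rayleigh maximum and top eigenvector\<close>

text \<open>For small s of sign opposite to c the linear term dominates. This serves as the
  first-order condition at an extremum.\<close>

lemma linear_coeff_zero:
  fixes c k :: real
  assumes "\<And>s. 2 * s * c + s\<^sup>2 * k \<ge> 0"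
  shows "c = 0"
proof (rule ccontr)
  assume c: "c \<noteq> 0"
  define m where "m = \<bar>k\<bar> + 1"
  have m: "m > 0" "k < m" by (auto simp: m_def)
  have "2 * (- c / m) * c + (- c / m)\<^sup>2 * k = c\<^sup>2 / m\<^sup>2 * (k - 2 * m)"
    using m by (simp add: field_simps power2_eq_square)
  moreover have "c\<^sup>2 / m\<^sup>2 * (k - 2 * m) < 0"
    using c m by (intro mult_pos_neg) auto
  ultimately show False using assms[of "- c / m"] by simp
qed

text \<open>The type \<open>'a\<close> may be infinite and functions carry the product topology.
  Vanishing outside \<open>V\<close> puts the sphere inside a product of the compact sets [-1, 1]
  and {0}, which is compact by Tychonoff.\<close>

lemma compact_unit_sphere_finite:
  assumes "finite V"
  shows "compact {z :: 'a \<Rightarrow> real. (\<forall>v. v \<notin> V \<longrightarrow> z v = 0) \<and> (\<Sum>v\<in>V. (z v)\<^sup>2) = 1}" (is "compact ?S")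
proof -
  define K where "K = (PiE UNIV (\<lambda>v. if v \<in> V then {-1..1} else {0}) :: ('a \<Rightarrow> real) set)"
  have "compactin (product_topology (\<lambda>_. euclidean) UNIV) K"
    unfolding K_def by (subst compactin_PiE) (auto simp: compactin_euclidean_iff)
  then have K: "compact K"
    by (simp add: euclidean_product_topology compactin_euclidean_iff)
  have cl: "closed {z :: 'a \<Rightarrow> real. (\<Sum>v\<in>V. (z v)\<^sup>2) = 1}"
    by (intro closed_Collect_eq continuous_intros continuous_on_product_coordinates)
  have "z \<in> K" if "z \<in> ?S" for z
  proof -
    have "\<bar>z v\<bar> \<le> 1" if "v \<in> V" for v
    proof -
      have "(z v)\<^sup>2 \<le> (\<Sum>v\<in>V. (z v)\<^sup>2)"
        using assms that by (intro member_le_sum) auto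
      then show ?thesis
        using \<open>z \<in> ?S\<close> by (simp add: abs_square_le_1)
    qed
    then show ?thesis
      using \<open>z \<in> ?S\<close> by (auto simp: K_def abs_le_iff minus_le_iff)
  qed
  moreover have "z v = 0" if "z \<in> K" "v \<notin> V" for z v
    using that unfolding K_def by (drule_tac PiE_mem[of _ _ _ v]) simp_all
  ultimately have "?S = K \<inter> {z. (\<Sum>v\<in>V. (z v)\<^sup>2) = 1}"
    by blast
  then show ?thesis
    using compact_Int_closed[OF K cl] by simp
qed

text \<open>The form attains its maximum on the unit sphere, and the first-order condition in every
  coordinate direction is the eigenvector equation.\<close>

lemma rayleigh_maximum:
  fixes a :: "'a \<Rightarrow> 'a \<Rightarrow> real"
  assumes V: "finite V" "V \<noteq> {}"
    and sym: "\<And>u v. u \<in> V \<Longrightarrow> v \<in> V \<Longrightarrow> a u v = a v u"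
  obtains x \<mu> where "(\<Sum>v\<in>V. (x v)\<^sup>2) = 1"
    and "\<And>v. v \<in> V \<Longrightarrow> (\<Sum>u\<in>V. a v u * x u) = \<mu> * x v"
    and "\<And>y. bil V a y y \<le> \<mu> * (\<Sum>v\<in>V. (y v)\<^sup>2)"
proof -
  define S where "S = {z :: 'a \<Rightarrow> real. (\<forall>v. v \<notin> V \<longrightarrow> z v = 0) \<and> (\<Sum>v\<in>V. (z v)\<^sup>2) = 1}"
  have "compact S"
    unfolding S_def by (rule compact_unit_sphere_finite[OF V(1)])
  moreover have "S \<noteq> {}"
  proof -
    obtain w where "w \<in> V" using V by blast
    then have "(\<lambda>v. if v = w then 1 else 0) \<in> S"
      using V by (auto simp: S_def if_distrib[of "\<lambda>x. x\<^sup>2"] cong: if_cong)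
    then show ?thesis by blast
  qed
  moreover have "continuous_on S (\<lambda>z. bil V a z z)"
    unfolding bil_def
    by (intro continuous_intros continuous_on_product_coordinates continuous_on_subset[OF _ subset_UNIV])
  ultimately obtain x where x: "x \<in> S" and max: "\<And>z. z \<in> S \<Longrightarrow> bil V a z z \<le> bil V a x x"
    using continuous_attains_sup[of S "\<lambda>z. bil V a z z"] by auto
  define \<mu> where "\<mu> = bil V a x x"
  have x1: "(\<Sum>v\<in>V. (x v)\<^sup>2) = 1" using x by (simp add: S_def)
  have le: "bil V a y y \<le> \<mu> * (\<Sum>v\<in>V. (y v)\<^sup>2)" for y
  proof (cases "(\<Sum>v\<in>V. (y v)\<^sup>2) = 0")
    case True
    then have "\<And>v. v \<in> V \<Longrightarrow> y v = 0"
      using V by (subst (asm) sum_nonneg_eq_0_iff) auto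
    then show ?thesis using True by (simp add: bil_def)
  next
    case False
    define N where "N = sqrt (\<Sum>v\<in>V. (y v)\<^sup>2)"
    have N2: "N\<^sup>2 = (\<Sum>v\<in>V. (y v)\<^sup>2)"
      unfolding N_def by (simp add: sum_nonneg)
    then have N0: "N \<noteq> 0" using False by auto
    \<comment> \<open>Besides being normalised, \<open>y\<close> is cut off outside
      \<open>V\<close>, as membership in \<open>S\<close> demands.\<close>
    define z where "z v = (if v \<in> V then y v / N else 0)" for v
    have "(\<Sum>v\<in>V. (z v)\<^sup>2) = (\<Sum>v\<in>V. (y v)\<^sup>2) / N\<^sup>2"
      unfolding sum_divide_distrib by (intro sum.cong) (auto simp: z_def power_divide)
    then have "z \<in> S"
      using N0 by (simp add: S_def z_def flip: N2)
    moreover have "bil V a z z = bil V a (\<lambda>v. inverse N * y v) (\<lambda>v. inverse N * y v)"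
      unfolding bil_def by (intro sum.cong) (auto simp: z_def field_simps)
    ultimately have "inverse N * inverse N * bil V a y y \<le> \<mu>"
      using max[of z] by (simp add: bil_scaleR \<mu>_def)
    then have "bil V a y y \<le> \<mu> * N\<^sup>2"
      using N0 by (simp add: divide_simps power2_eq_square mult_ac split: if_splits)
    then show ?thesis by (simp add: N2)
  qed
  have ev: "(\<Sum>u\<in>V. a w u * x u) = \<mu> * x w" if w: "w \<in> V" for w
  proof -
    define e where "e v = (if v = w then 1 else 0 :: real)" for v
    define k where "k = \<mu> - bil V a e e"
    have ee: "(\<Sum>v\<in>V. x v * e v) = x w" "(\<Sum>v\<in>V. (e v)\<^sup>2) = 1"
    proof -
      have "(\<Sum>v\<in>V. x v * e v) = (\<Sum>v\<in>V. if v = w then x w else 0)"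
        by (intro sum.cong) (auto simp: e_def)
      then show "(\<Sum>v\<in>V. x v * e v) = x w"
        using V w by simp
      have "(\<Sum>v\<in>V. (e v)\<^sup>2) = (\<Sum>v\<in>V. if v = w then 1 else 0)"
        by (intro sum.cong) (auto simp: e_def)
      then show "(\<Sum>v\<in>V. (e v)\<^sup>2) = 1"
        using V w by simp
    qed
    have ae: "bil V a e x = (\<Sum>u\<in>V. a w u * x u)"
      using V w by (simp add: bil_eq e_def if_distrib[of "\<lambda>x. x * _"] cong: if_cong)
    \<comment> \<open>The left side is \<mu> times the squared norm of x + s * e, minus the form
      there; it is 0 at s = 0 and never negative.\<close>
    have "2 * s * (\<mu> * x w - bil V a e x) + s\<^sup>2 * k \<ge> 0" for s
    proof -
      have "(\<Sum>v\<in>V. (x v + s * e v)\<^sup>2) = (\<Sum>v\<in>V. (x v)\<^sup>2) + 2 * s * (\<Sum>v\<in>V. x v * e v) + s\<^sup>2 * (\<Sum>v\<in>V. (e v)\<^sup>2)"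
        by (simp add: power2_eq_square algebra_simps sum.distrib sum_distrib_left)
      then have "(\<Sum>v\<in>V. (x v + s * e v)\<^sup>2) = 1 + 2 * s * x w + s\<^sup>2"
        using x1 ee by simp
      then show ?thesis
        using le[of "\<lambda>v. x v + s * e v"] bil_add_square[of V a x s e, OF sym]
        by (simp add: k_def \<mu>_def algebra_simps)
    qed
    from linear_coeff_zero[OF this] show ?thesis
      using ae by simp
  qed
  show thesis using that[OF x1 ev le] .
qed

section \<open>Test vectors: restriction, projection and row sums\<close>

text \<open>Extension by zero transfers bounds on the form from a graph to its induced subgraphs;
  with it neighbourhoods inherit the constant \<open>L\<close>.\<close>

lemma bil_restrict:
  assumes "finite V" "W \<subseteq> V"
  shows "bil V a (\<lambda>v. if v \<in> W then x v else 0) (\<lambda>v. if v \<in> W then y v else 0) = bil W a x y"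
  unfolding bil_eq using assms
  by (intro sum.mono_neutral_cong_right arg_cong2[of _ _ _ _ "(*)"]) auto

text \<open>Split y into its projection c * x on the unit eigenvector and an orthogonal rest. The
  cross terms of the form A + L I vanish, the rest contributes at least 0, and the projection
  contributes (\<mu> + L) * c^2.\<close>

lemma bil_psd_lower:
  assumes sym: "\<And>u v. u \<in> V \<Longrightarrow> v \<in> V \<Longrightarrow> a u v = a v u"
    and psd: "\<And>y. bil V a y y + L * (\<Sum>v\<in>V. (y v)\<^sup>2) \<ge> 0"
    and x1: "(\<Sum>v\<in>V. (x v)\<^sup>2) = 1"
    and ev: "\<And>v. v \<in> V \<Longrightarrow> (\<Sum>u\<in>V. a v u * x u) = \<mu> * x v"
  shows "(\<mu> + L) * (\<Sum>v\<in>V. x v * y v)\<^sup>2 \<le> bil V a y y + L * (\<Sum>v\<in>V. (y v)\<^sup>2)"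
proof -
  define c where "c = (\<Sum>v\<in>V. x v * y v)"
  have ax: "bil V a y' x = \<mu> * (\<Sum>v\<in>V. x v * y' v)" for y'
  proof -
    have "bil V a y' x = (\<Sum>v\<in>V. y' v * (\<mu> * x v))"
      unfolding bil_eq by (intro sum.cong) (auto simp: ev)
    then show ?thesis by (simp add: sum_distrib_left mult_ac)
  qed
  have xx: "bil V a x x = \<mu>"
    using ax[of x] x1 by (simp add: power2_eq_square)
  have xy: "bil V a x y = \<mu> * c"
    using ax[of y] bil_commute[of V a x y, OF sym] by (simp add: c_def)
  have "(\<Sum>v\<in>V. (y v + (- c) * x v)\<^sup>2)
      = (\<Sum>v\<in>V. (y v)\<^sup>2) - 2 * c * (\<Sum>v\<in>V. x v * y v) + c\<^sup>2 * (\<Sum>v\<in>V. (x v)\<^sup>2)"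
    by (simp add: power2_eq_square algebra_simps sum.distrib sum_subtractf sum_distrib_left)
  also have "\<dots> = (\<Sum>v\<in>V. (y v)\<^sup>2) - c\<^sup>2"
    unfolding x1 c_def[symmetric] by (simp add: power2_eq_square)
  finally have "bil V a y y + 2 * (- c) * (\<mu> * c) + (- c)\<^sup>2 * \<mu> + L * ((\<Sum>v\<in>V. (y v)\<^sup>2) - c\<^sup>2) \<ge> 0"
    using psd[of "\<lambda>v. y v + (- c) * x v"] bil_add_square[of V a y "- c" x, OF sym]
    by (simp only: xx xy)
  then show ?thesis
    unfolding c_def[symmetric] by (simp add: power2_eq_square algebra_simps)
qed

text \<open>This is |A1|^2 \<le> \<mu>^2 |1|^2. With nonnegative entries, replacing y by its
  absolute values shows that \<mu> also bounds the negative of the form; polarisation then bounds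
  the bilinear form, which is tested on A1 and a constant vector.\<close>

lemma sum_row_squares_le:
  assumes fin: "finite V"
    and sym: "\<And>u v. u \<in> V \<Longrightarrow> v \<in> V \<Longrightarrow> a u v = a v u"
    and nonneg: "\<And>u v. u \<in> V \<Longrightarrow> v \<in> V \<Longrightarrow> a u v \<ge> 0"
    and mu: "\<mu> \<ge> 0"
    and max: "\<And>y. bil V a y y \<le> \<mu> * (\<Sum>v\<in>V. (y v)\<^sup>2)"
  shows "(\<Sum>v\<in>V. (\<Sum>u\<in>V. a v u)\<^sup>2) \<le> \<mu>\<^sup>2 * real (card V)"
proof -
  have min: "- bil V a y y \<le> \<mu> * (\<Sum>v\<in>V. (y v)\<^sup>2)" for y
  proof -
    have "- bil V a y y \<le> bil V a (\<lambda>v. \<bar>y v\<bar>) (\<lambda>v. \<bar>y v\<bar>)"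
      unfolding bil_def sum_negf[symmetric]
    proof (intro sum_mono)
      fix u v assume uv: "u \<in> V" "v \<in> V"
      have "a u v * (- (y u * y v)) \<le> a u v * (\<bar>y u\<bar> * \<bar>y v\<bar>)"
        using nonneg[OF uv] abs_ge_minus_self[of "y u * y v"]
        by (intro mult_left_mono) (auto simp: abs_mult)
      then show "- (a u v * y u * y v) \<le> a u v * \<bar>y u\<bar> * \<bar>y v\<bar>"
        by (simp add: mult_ac)
    qed
    also have "\<dots> \<le> \<mu> * (\<Sum>v\<in>V. (y v)\<^sup>2)"
      using max[of "\<lambda>v. \<bar>y v\<bar>"] by simp
    finally show ?thesis .
  qed
  have polar: "2 * bil V a w u \<le> \<mu> * ((\<Sum>v\<in>V. (u v)\<^sup>2) + (\<Sum>v\<in>V. (w v)\<^sup>2))" for u w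
  proof -
    have "(\<Sum>v\<in>V. (u v + 1 * w v)\<^sup>2) + (\<Sum>v\<in>V. (u v + (- 1) * w v)\<^sup>2)
        = 2 * ((\<Sum>v\<in>V. (u v)\<^sup>2) + (\<Sum>v\<in>V. (w v)\<^sup>2))"
      by (simp add: power2_eq_square algebra_simps sum.distrib sum_subtractf sum_distrib_left)
    then have "\<mu> * (\<Sum>v\<in>V. (u v + 1 * w v)\<^sup>2) + \<mu> * (\<Sum>v\<in>V. (u v + (- 1) * w v)\<^sup>2)
        = 2 * (\<mu> * ((\<Sum>v\<in>V. (u v)\<^sup>2) + (\<Sum>v\<in>V. (w v)\<^sup>2)))"
      unfolding distrib_left[symmetric] by simp
    then show ?thesis
      using max[of "\<lambda>v. u v + 1 * w v"] min[of "\<lambda>v. u v + (- 1) * w v"]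
        bil_add_square[of V a u 1 w, OF sym] bil_add_square[of V a u "- 1" w, OF sym]
      by simp
  qed
  define d where "d v = (\<Sum>u\<in>V. a v u)" for v
  define D where "D = (\<Sum>v\<in>V. (d v)\<^sup>2)"
  have key: "2 * c * D \<le> \<mu> * (c\<^sup>2 * card V + D)" for c
  proof -
    have "bil V a d (\<lambda>_. c) = c * D"
      unfolding bil_eq D_def d_def sum_distrib_left
      by (intro sum.cong) (auto simp: power2_eq_square sum_distrib_left mult_ac)
    then show ?thesis
      using polar[of d "\<lambda>_. c"] by (simp add: D_def mult_ac)
  qed
  have "D \<le> \<mu>\<^sup>2 * real (card V)"
  proof (cases "\<mu> = 0")
    case True
    then show ?thesis using key[of 1] by simp
  next
    case False
    then have "\<mu> > 0" using mu by simp
    \<comment> \<open>The choice c = \<mu> is the one that makes \<open>key\<close> sharp when D =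
      \<mu>^2 * card V.\<close>
    moreover have "\<mu> * (2 * D) \<le> \<mu> * (\<mu>\<^sup>2 * card V + D)"
      using key[of \<mu>] by (simp add: mult_ac)
    ultimately show ?thesis by simp
  qed
  then show ?thesis by (simp add: D_def d_def)
qed

section \<open>Clique-free graphs\<close>

definition edge_weight :: "('a \<Rightarrow> 'a \<Rightarrow> bool) \<Rightarrow> 'a \<Rightarrow> 'a \<Rightarrow> real" where
  "edge_weight E u v = (if E u v then 1 else 0)"

text \<open>A relation with a separate vertex set allows the induction to move to a neighbourhood
  without building a new digraph.\<close>

definition clique_free :: "('a \<Rightarrow> 'a \<Rightarrow> bool) \<Rightarrow> 'a set \<Rightarrow> nat \<Rightarrow> bool" where
  "clique_free E V k \<longleftrightarrow>
    \<not> (\<exists>K \<subseteq> V. card K = k \<and> (\<forall>u\<in>K. \<forall>v\<in>K. u \<noteq> v \<longrightarrow> E u v))"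

text \<open>A clique among the neighbours of v can be enlarged by v, which is not its own
  neighbour.\<close>

lemma clique_free_neighbourhood:
  assumes sym: "\<And>u v. E u v \<Longrightarrow> E v u" and irrefl: "\<not> E v v"
    and "finite V" "v \<in> V" "clique_free E V (Suc k)"
  shows "clique_free E {u \<in> V. E v u} k"
  unfolding clique_free_def
proof (intro notI, elim exE conjE)
  fix K assume K: "K \<subseteq> {u \<in> V. E v u}" "card K = k" "\<forall>u\<in>K. \<forall>v\<in>K. u \<noteq> v \<longrightarrow> E u v"
  then have "finite K" "v \<notin> K"
    using irrefl \<open>finite V\<close> by (auto intro: finite_subset)
  then have "card (insert v K) = Suc k" "insert v K \<subseteq> V"
    using K \<open>v \<in> V\<close> by auto
  moreover have "\<forall>u\<in>insert v K. \<forall>w\<in>insert v K. u \<noteq> w \<longrightarrow> E u w"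
    using K sym by auto
  ultimately show False
    using assms(5) unfolding clique_free_def by blast
qed

text \<open>The conclusion places (n, \<mu> + L) below the tangent at parameter t to the curve (L t
  P, L P), where P is \<open>geom (Suc r)\<close>. \<open>L\<close> and \<open>t\<close> stay fixed
  in the induction; the vertex set and its top eigenpair vary.\<close>

lemma clique_free_spectral_bound:
  fixes E :: "'a \<Rightarrow> 'a \<Rightarrow> bool"
  assumes L: "L > 0" and t: "t \<ge> 0"
    and sym: "\<And>u v. E u v \<Longrightarrow> E v u" and irrefl: "\<And>v. \<not> E v v"
  defines "a \<equiv> edge_weight E"
  assumes "finite V" "V \<noteq> {}" "clique_free E V (Suc (Suc r))"
    and "\<And>y. bil V a y y + L * (\<Sum>v\<in>V. (y v)\<^sup>2) \<ge> 0"
    and "(\<Sum>v\<in>V. (x v)\<^sup>2) = 1"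
    and "\<And>v. v \<in> V \<Longrightarrow> (\<Sum>u\<in>V. a v u * x u) = \<mu> * x v"
    and "\<And>y. bil V a y y \<le> \<mu> * (\<Sum>v\<in>V. (y v)\<^sup>2)"
  shows "(geom (Suc r) t + t * dgeom (Suc r) t) * (\<mu> + L)
    \<le> dgeom (Suc r) t * real (card V) + (geom (Suc r) t)\<^sup>2 * L"
  using assms(6-)
proof (induction r arbitrary: V x \<mu>)
  case (0 V x \<mu>)
  \<comment> \<open>Without edges \<mu> is 0, while \<open>geom\<close> is 1 and
    \<open>dgeom\<close> is 0, so the claim becomes L \<le> L.\<close>
  have "\<not> E u v" if "u \<in> V" "v \<in> V" for u v
  proof
    assume E: "E u v"
    then have "u \<noteq> v" using irrefl by blast
    then have "card {u, v} = Suc (Suc 0)" by simp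
    moreover have "\<forall>p\<in>{u,v}. \<forall>q\<in>{u,v}. p \<noteq> q \<longrightarrow> E p q" using E sym by auto
    ultimately show False
      using 0(3) that unfolding clique_free_def by (metis empty_subsetI insert_subset)
  qed
  then have "\<mu> * x v = 0" if "v \<in> V" for v
    using 0(6)[OF that] that by (simp add: a_def edge_weight_def)
  then have "\<mu> = 0 \<or> (\<forall>v\<in>V. x v = 0)"
    by auto
  then have "\<mu> = 0"
    using 0(5) by auto
  then show ?case by simp
next
  case (Suc r V x \<mu>)
  note fin = Suc.prems(1) and psd = Suc.prems(4) and x1 = Suc.prems(5)
    and ev = Suc.prems(6) and max = Suc.prems(7)
  define n where "n = real (card V)"
  define N where "N v = {u \<in> V. E v u}" for v
  define d where "d v = real (card (N v))" for v
  \<comment> \<open>Ordered pairs are counted, so \<open>e v\<close> is twice the number of edges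
    inside \<open>N v\<close>.\<close>
  define e where "e v = bil (N v) a (\<lambda>_. 1) (\<lambda>_. 1)" for v
  define Q where "Q = geom (Suc r) t"
  define Q' where "Q' = dgeom (Suc r) t"
  have Q: "Q \<ge> 0" "Q' \<ge> 0" "Q + t * Q' \<ge> 0"
    using t geom_nonneg dgeom_nonneg by (auto simp only: Q_def Q'_def intro!: add_nonneg_nonneg mult_nonneg_nonneg)
  have NV: "N v \<subseteq> V" "finite (N v)" for v
    using fin by (auto simp: N_def)
  have asym: "a u v = a v u" for u v
    using sym by (auto simp: a_def edge_weight_def)
  have row: "(\<Sum>u\<in>V. a v u * y u) = (\<Sum>u\<in>V. y u * (if u \<in> N v then 1 else 0))" for v y
    by (intro sum.cong) (auto simp: a_def edge_weight_def N_def)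
  have card_sum: "(\<Sum>u\<in>V. if u \<in> N v then 1 else 0) = d v" for v
    using fin NV[of v] by (simp add: d_def sum.If_cases Int_absorb1)
  have deg: "(\<Sum>u\<in>V. a v u) = d v" for v
    using row[of v "\<lambda>_. 1"] card_sum[of v] by simp
  have psdN: "bil (N v) a y y + L * (\<Sum>u\<in>N v. (y u)\<^sup>2) \<ge> 0" for v y
  proof -
    have "(\<Sum>u\<in>V. (if u \<in> N v then y u else 0)\<^sup>2) = (\<Sum>u\<in>N v. (y u)\<^sup>2)"
      using fin NV[of v] by (intro sum.mono_neutral_cong_right) auto
    then show ?thesis
      using psd[of "\<lambda>u. if u \<in> N v then y u else 0"] bil_restrict[OF fin NV(1)] by simp
  qed
  \<comment> \<open>The all-ones vector gives e v \<le> \<nu> * d v for the top eigenvalue \<nu> of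
    the neighbourhood, and induction bounds \<nu> + L. An empty neighbourhood has no eigenvector,
    but then both sides are 0.\<close>
  have upper: "(Q + t * Q') * (e v + L * d v) \<le> (Q' * d v + Q\<^sup>2 * L) * d v" if v: "v \<in> V" for v
  proof (cases "N v = {}")
    case True
    then show ?thesis by (simp add: e_def d_def bil_def)
  next
    case False
    obtain z \<nu> where z: "(\<Sum>u\<in>N v. (z u)\<^sup>2) = 1"
      "\<And>w. w \<in> N v \<Longrightarrow> (\<Sum>u\<in>N v. a w u * z u) = \<nu> * z w"
      "\<And>y. bil (N v) a y y \<le> \<nu> * (\<Sum>u\<in>N v. (y u)\<^sup>2)"
      using rayleigh_maximum[OF NV(2) False, of a] asym by blast
    have "clique_free E (N v) (Suc (Suc r))"
      unfolding N_def using clique_free_neighbourhood[of E v V] sym irrefl fin v Suc.prems(3) by blast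
    then have "(Q + t * Q') * (\<nu> + L) \<le> Q' * d v + Q\<^sup>2 * L"
      using Suc.IH[OF NV(2) False _ psdN z] by (simp only: Q_def Q'_def d_def)
    then have "(Q + t * Q') * (\<nu> + L) * d v \<le> (Q' * d v + Q\<^sup>2 * L) * d v"
      by (intro mult_right_mono) (auto simp: d_def)
    moreover have "(Q + t * Q') * (e v + L * d v) \<le> (Q + t * Q') * ((\<nu> + L) * d v)"
      using z(3)[of "\<lambda>_. 1"] Q by (intro mult_left_mono) (auto simp: e_def d_def algebra_simps)
    ultimately show ?thesis by (simp add: mult_ac)
  qed
  have lower: "(\<mu> + L) * (\<mu> * x v)\<^sup>2 \<le> e v + L * d v" if v: "v \<in> V" for v
  proof -
    have "(\<Sum>u\<in>V. x u * (if u \<in> N v then 1 else 0)) = \<mu> * x v"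
      using ev[OF v] row[of v x] by simp
    moreover have "bil V a (\<lambda>u. if u \<in> N v then 1 else 0) (\<lambda>u. if u \<in> N v then 1 else 0) = e v"
      unfolding e_def using bil_restrict[OF fin NV(1)] .
    moreover have "(\<Sum>u\<in>V. (if u \<in> N v then 1 else 0 :: real)\<^sup>2) = d v"
      unfolding card_sum[symmetric] by (intro sum.cong) auto
    ultimately show ?thesis
      using bil_psd_lower[of V a L x \<mu> "\<lambda>u. if u \<in> N v then 1 else 0", OF asym psd x1 ev] by simp
  qed
  \<comment> \<open>Testing with the all-ones vector bounds the average degree by \<mu>; hence also
    \<mu> \<ge> 0.\<close>
  have sum_d: "(\<Sum>v\<in>V. d v) \<le> \<mu> * n"
    using max[of "\<lambda>_. 1"] by (simp add: bil_eq deg n_def)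
  moreover have "(\<Sum>v\<in>V. d v) \<ge> 0"
    by (intro sum_nonneg) (simp add: d_def)
  moreover have n: "n > 0"
    using Suc.prems(1,2) by (simp add: n_def card_gt_0_iff)
  ultimately have mu: "\<mu> \<ge> 0"
    by (metis le_less_trans linorder_not_le mult_neg_pos order.strict_trans1)
  have sum_d2: "(\<Sum>v\<in>V. (d v)\<^sup>2) \<le> \<mu>\<^sup>2 * n"
    using sum_row_squares_le[of V a \<mu>, OF fin asym _ mu max]
    by (simp add: deg n_def) (simp add: a_def edge_weight_def)
  \<comment> \<open>As x is a unit vector, summing \<open>lower\<close> over the vertices produces
    \<mu>^2. Bounding the sums of d and d^2 by \<mu> * n and \<mu>^2 * n leads to the hypothesis of
    \<open>tangent_step\<close>.\<close>
  have "(Q + t * Q') * (\<mu> + L) * \<mu>\<^sup>2 = (Q + t * Q') * (\<Sum>v\<in>V. (\<mu> + L) * (\<mu> * x v)\<^sup>2)"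
    by (simp add: power_mult_distrib x1 mult_ac flip: sum_distrib_left)
  also have "\<dots> \<le> (Q + t * Q') * (\<Sum>v\<in>V. e v + L * d v)"
    using Q lower by (intro mult_left_mono sum_mono) auto
  also have "\<dots> \<le> (\<Sum>v\<in>V. (Q' * d v + Q\<^sup>2 * L) * d v)"
    unfolding sum_distrib_left using upper by (intro sum_mono)
  also have "\<dots> = Q' * (\<Sum>v\<in>V. (d v)\<^sup>2) + Q\<^sup>2 * L * (\<Sum>v\<in>V. d v)"
    by (simp add: sum.distrib sum_distrib_left algebra_simps power2_eq_square)
  also have "\<dots> \<le> Q' * (\<mu>\<^sup>2 * n) + Q\<^sup>2 * L * (\<mu> * n)"
    using sum_d sum_d2 Q L by (intro add_mono mult_left_mono) auto
  also have "\<dots> = n * \<mu> * (Q' * \<mu> + Q\<^sup>2 * L)"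
    by (simp add: power2_eq_square algebra_simps)
  finally show ?case
    using tangent_step[OF L t mu, of n r] n unfolding Q_def Q'_def n_def by simp
qed

section \<open>Real symmetric matrices and graph eigenvalues\<close>

text \<open>This links matrix eigenvalues to the sums used with \<open>bil\<close>. The ring is
  general because both real and complex matrices occur below.\<close>

lemma eigenvalue_mat_iff:
  fixes a :: "nat \<Rightarrow> nat \<Rightarrow> 'b :: comm_ring_1"
  shows "eigenvalue (mat n n (\<lambda>(i, j). a i j)) k \<longleftrightarrow>
    (\<exists>y. (\<exists>i<n. y i \<noteq> 0) \<and> (\<forall>i<n. (\<Sum>j<n. a i j * y j) = k * y i))"
proof
  assume "eigenvalue (mat n n (\<lambda>(i, j). a i j)) k"
  then obtain v where v: "v \<in> carrier_vec n" "v \<noteq> 0\<^sub>v n"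
    "mat n n (\<lambda>(i, j). a i j) *\<^sub>v v = k \<cdot>\<^sub>v v"
    by (auto simp: eigenvalue_def eigenvector_def)
  have "\<exists>i<n. vec_index v i \<noteq> 0"
  proof (rule ccontr)
    assume "\<not> ?thesis"
    then have "v = 0\<^sub>v n" using v(1) by (intro eq_vecI) auto
    then show False using v(2) by simp
  qed
  moreover have "(\<Sum>j<n. a i j * vec_index v j) = k * vec_index v i" if "i < n" for i
    using arg_cong[OF v(3), of "\<lambda>w. vec_index w i"] that v(1)
    by (simp add: scalar_prod_def lessThan_atLeast0)
  ultimately show "\<exists>y. (\<exists>i<n. y i \<noteq> 0) \<and> (\<forall>i<n. (\<Sum>j<n. a i j * y j) = k * y i)"
    by blast
next
  assume "\<exists>y. (\<exists>i<n. y i \<noteq> 0) \<and> (\<forall>i<n. (\<Sum>j<n. a i j * y j) = k * y i)"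
  then obtain y i where y: "i < n" "y i \<noteq> 0" "\<And>i. i < n \<Longrightarrow> (\<Sum>j<n. a i j * y j) = k * y i"
    by blast
  have "vec n y \<noteq> 0\<^sub>v n"
    using y(1,2) by (metis index_vec index_zero_vec(1))
  moreover have "mat n n (\<lambda>(i, j). a i j) *\<^sub>v vec n y = k \<cdot>\<^sub>v vec n y"
    using y(3) by (intro eq_vecI) (auto simp: scalar_prod_def lessThan_atLeast0)
  ultimately show "eigenvalue (mat n n (\<lambda>(i, j). a i j)) k"
    unfolding eigenvalue_def eigenvector_def by (intro exI[of _ "vec n y"]) auto
qed

text \<open>For an eigenvector y the number y* A y equals k * |y|^2, and by symmetry it is its own
  conjugate.\<close>

lemma real_symmetric_eigenvalue_real:
  fixes a :: "nat \<Rightarrow> nat \<Rightarrow> real"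
  assumes sym: "\<And>i j. a i j = a j i"
    and ev: "eigenvalue (mat n n (\<lambda>(i, j). complex_of_real (a i j))) k"
  shows "k \<in> \<real>"
proof -
  obtain y i where i: "i < n" "y i \<noteq> 0"
    and y: "\<And>i. i < n \<Longrightarrow> (\<Sum>j<n. complex_of_real (a i j) * y j) = k * y i"
    using ev unfolding eigenvalue_mat_iff by blast
  define S where "S = (\<Sum>i<n. \<Sum>j<n. complex_of_real (a i j) * (cnj (y i) * y j))"
  define N where "N = (\<Sum>i<n. (cmod (y i))\<^sup>2)"
  have "S = (\<Sum>i<n. cnj (y i) * (\<Sum>j<n. complex_of_real (a i j) * y j))"
    unfolding S_def sum_distrib_left by (intro sum.cong) (auto simp: mult_ac)
  also have "\<dots> = (\<Sum>i<n. cnj (y i) * (k * y i))"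
    by (intro sum.cong) (auto simp: y)
  also have "\<dots> = k * complex_of_real N"
    unfolding N_def of_real_sum sum_distrib_left
    by (intro sum.cong) (auto simp: complex_norm_square mult_ac simp del: of_real_power)
  finally have S: "S = k * complex_of_real N" .
  have "cnj S = S"
    unfolding S_def cnj_sum by (subst sum.swap) (auto intro!: sum.cong simp: sym mult_ac)
  then have "S \<in> \<real>"
    by (simp add: Reals_cnj_iff)
  moreover have "(cmod (y i))\<^sup>2 \<le> N"
    unfolding N_def using i by (intro member_le_sum) auto
  then have "N \<noteq> 0"
    using i by (smt (verit) zero_less_norm_iff zero_less_power)
  then have "k = S / complex_of_real N"
    by (simp add: S)
  ultimately show ?thesis
    by simp
qed

text \<open>Over the complex numbers the polynomial factors and all roots are real; the
  factorisation descends because the embedding of real polynomials is injective.\<close>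

lemma real_symmetric_char_poly_splits:
  fixes a :: "nat \<Rightarrow> nat \<Rightarrow> real"
  assumes sym: "\<And>i j. a i j = a j i"
  obtains bs where "char_poly (mat n n (\<lambda>(i, j). a i j)) = (\<Prod>b\<leftarrow>bs. [:- b, 1:])" "length bs = n"
proof -
  define A where "A = mat n n (\<lambda>(i, j). a i j)"
  define C where "C = mat n n (\<lambda>(i, j). complex_of_real (a i j))"
  have A: "A \<in> carrier_mat n n" and C: "C \<in> carrier_mat n n"
    by (auto simp: A_def C_def)
  have CA: "C = map_mat complex_of_real A"
    by (auto simp: A_def C_def intro!: eq_matI)
  interpret h: map_poly_inj_idom_hom complex_of_real ..
  obtain as where as: "char_poly C = (\<Prod>a\<leftarrow>as. [:- a, 1:])" "length as = n"
    using char_poly_factorized[OF C] by blast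
  have real: "complex_of_real (Re z) = z" if "z \<in> set as" for z
  proof -
    have "poly (char_poly C) z = 0"
      unfolding as(1) using that by (auto simp: poly_prod_list_zero_iff intro!: bexI[of _ z])
    then have "eigenvalue C z"
      by (simp add: eigenvalue_root_char_poly[OF C])
    then show ?thesis
      using real_symmetric_eigenvalue_real[OF sym] unfolding C_def by (simp add: of_real_Re)
  qed
  define bs where "bs = map Re as"
  have "map_poly complex_of_real (char_poly A) = char_poly C"
    unfolding CA by (rule of_real_hom.char_poly_hom[OF A, symmetric])
  also have "\<dots> = (\<Prod>b\<leftarrow>bs. [:- complex_of_real b, 1:])"
    unfolding as(1) bs_def map_map by (intro arg_cong[of _ _ prod_list] map_cong) (auto simp: real)
  also have "\<dots> = map_poly complex_of_real (\<Prod>b\<leftarrow>bs. [:- b, 1:])"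
    by (simp add: h.hom_prod_list o_def)
  finally have "char_poly A = (\<Prod>b\<leftarrow>bs. [:- b, 1:])"
    by simp
  then show thesis
    using that[of bs] as(2) by (simp add: A_def bs_def)
qed

lemma proots_prod_linear: "proots (\<Prod>b\<leftarrow>bs. [:- b, 1:]) = mset bs"
  for bs :: "'b :: idom list"
proof (induction bs)
  case (Cons b bs)
  moreover have "(\<Prod>b\<leftarrow>bs. [:- b, 1:]) \<noteq> 0"
    by (auto simp: prod_list_zero_iff)
  ultimately show ?case
    by (simp add: proots_mult del: mult_pCons_left)
qed auto

section \<open>From digraphs to forms: extremal eigenvalues and cliques\<close>

lemma graph_eigenvalues_extremal:
  fixes G :: "('a, 'b) pre_digraph"
  assumes "graph G" "verts G \<noteq> {}"
    and vs: "vertex_enum G vs"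
  defines "n \<equiv> graph_order G"
  defines "A \<equiv> adj_matrix_of G vs"
  shows "eigenvalue A (graph_eigenvalue 1 G)"
    and "eigenvalue A k \<Longrightarrow> graph_eigenvalue n G \<le> k"
proof -
  interpret graph G by fact
  have n: "length vs = n" "n > 0"
    using vs assms(2) finite_verts
    by (auto simp: n_def vertex_enum_def card_gt_0_iff dest: distinct_card)
  have A: "A = mat n n (\<lambda>(i, j). if i < n \<and> j < n \<and> (vs ! i, vs ! j) \<in> arcs_ends G then 1 else 0)"
    unfolding A_def adj_matrix_of_def n(1) by (intro eq_matI) auto
  have Ac: "A \<in> carrier_mat n n"
    by (simp add: A)
  have sym: "(if i < n \<and> j < n \<and> (vs ! i, vs ! j) \<in> arcs_ends G then 1 else 0 :: real)
      = (if j < n \<and> i < n \<and> (vs ! j, vs ! i) \<in> arcs_ends G then 1 else 0)" for i j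
    using arcs_ends_symmetric[OF sym_arcs] by auto
  obtain bs where bs: "char_poly A = (\<Prod>b\<leftarrow>bs. [:- b, 1:])" "length bs = n"
    unfolding A by (rule real_symmetric_char_poly_splits[OF sym])
  have ev: "eigenvalue A k \<longleftrightarrow> k \<in> set bs" for k
    unfolding eigenvalue_root_char_poly[OF Ac] bs(1)
    by (auto simp: poly_prod_list_zero_iff)
  have l: "graph_eigenvalues G = rev (sort bs)"
    unfolding graph_eigenvalues_def char_poly_adj_matrix[OF vs] A_def[symmetric] bs(1)
      proots_prod_linear by simp
  have "graph_eigenvalues G ! 0 \<in> set (graph_eigenvalues G)"
    using n bs(2) by (intro nth_mem) (simp add: l)
  then show "eigenvalue A (graph_eigenvalue 1 G)"
    unfolding ev by (simp add: graph_eigenvalue_def l)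
  assume "eigenvalue A k"
  then have "k \<in> set (sort bs)" by (simp add: ev)
  then obtain i where i: "i < n" "sort bs ! i = k"
    using bs(2) by (metis in_set_conv_nth length_sort)
  \<comment> \<open>Counting from 1 puts the n-th eigenvalue at index n - 1 of the reversed list,
    the head of the ascending one.\<close>
  have "graph_eigenvalue n G = sort bs ! 0"
    using n bs(2) by (simp add: graph_eigenvalue_def l rev_nth)
  also have "\<dots> \<le> sort bs ! i"
    using i bs(2) by (intro sorted_nth_mono) auto
  finally show "graph_eigenvalue n G \<le> k" using i by simp
qed

text \<open>A clique of indices names equally many vertices, since \<open>vs\<close> is distinct,
  and the subgraph of \<open>G\<close> induced on them is a complete digraph.\<close>

lemma K_free_imp_clique_free:
  assumes "graph G" "vertex_enum G vs" "K_free k G"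
  shows "clique_free (\<lambda>i j. i < length vs \<and> j < length vs \<and> (vs ! i, vs ! j) \<in> arcs_ends G) {..<length vs} k"
  unfolding clique_free_def
proof (intro notI, elim exE conjE)
  interpret graph G by fact
  fix K
  assume K: "K \<subseteq> {..<length vs}" "card K = k"
    and cl: "\<forall>i\<in>K. \<forall>j\<in>K. i \<noteq> j \<longrightarrow> i < length vs \<and> j < length vs \<and> (vs ! i, vs ! j) \<in> arcs_ends G"
  define S where "S = (!) vs ` K"
  define H where "H = G \<restriction> S"
  have vs: "distinct vs" "set vs = verts G"
    using assms(2) by (auto simp: vertex_enum_def)
  have "inj_on ((!) vs) K"
    using K(1) vs(1) by (intro inj_on_nth) auto
  then have card: "card S = k"
    using K(2) by (simp add: S_def card_image)
  have "S \<subseteq> verts G"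
    using K(1) by (auto simp: S_def simp flip: vs(2) intro!: nth_mem)
  then have ind: "induced_subgraph H G"
    unfolding H_def by (rule induced_induce)
  then have "graph H"
    using digraphI_induced[OF ind] induced_graph_imp_symmetric[OF sym_arcs ind] digraph.graphI by blast
  moreover have "arcs_ends H = {(u, v). (u, v) \<in> verts H \<times> verts H \<and> u \<noteq> v}"
  proof (intro equalityI subrelI)
    fix u v assume "(u, v) \<in> arcs_ends H"
    then show "(u, v) \<in> {(u, v). (u, v) \<in> verts H \<times> verts H \<and> u \<noteq> v}"
      by (auto simp: H_def arcs_ends_conv dest: no_loops)
  next
    fix u v assume "(u, v) \<in> {(u, v). (u, v) \<in> verts H \<times> verts H \<and> u \<noteq> v}"
    then have uv: "u \<in> verts H" "v \<in> verts H" "u \<noteq> v" by auto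
    then obtain i j where "i \<in> K" "j \<in> K" "u = vs ! i" "v = vs ! j" "i \<noteq> j"
      by (auto simp: H_def S_def)
    then have "(u, v) \<in> arcs_ends G" using cl by blast
    then show "(u, v) \<in> arcs_ends H"
      using uv by (auto simp: H_def arcs_ends_conv)
  qed
  ultimately have "K\<^bsub>k\<^esub> H"
    using card by (simp add: complete_digraph_def H_def)
  moreover have "subgraph H G"
    using ind by (simp add: induced_subgraph_def)
  ultimately show False
    using assms(3) by (auto simp: K_free_def)
qed

section \<open>The eigenvalue bound for graphs\<close>

theorem theorem1p11:
  fixes G :: "('a, 'b) pre_digraph" and r :: nat
  assumes "r \<ge> 1"
    and "graph G" and "verts G \<noteq> {}"
    and "K_free (r + 1) G"
  shows "(graph_eigenvalue 1 G + graph_eigenvalue (graph_order G) G) / real (graph_order G)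
           \<le> (2 * sqrt (1 - 1 / real r) - 1)\<^sup>2"
proof -
  interpret graph G by fact
  obtain k where k: "r = Suc k"
    using assms(1) by (cases r) auto
  obtain vs where vs: "vertex_enum G vs"
    using finite_distinct_list[OF finite_verts] by (auto simp: vertex_enum_def)
  define n where "n = graph_order G"
  have n: "length vs = n" "n > 0"
    using vs assms(3) finite_verts
    by (auto simp: n_def vertex_enum_def card_gt_0_iff dest: distinct_card)
  define V where "V = {..<n}"
  have V: "finite V" "V \<noteq> {}" "card V = n"
    using n by (auto simp: V_def)
  define E where "E i j \<longleftrightarrow> i < n \<and> j < n \<and> (vs ! i, vs ! j) \<in> arcs_ends G" for i j
  define a where "a = edge_weight E"
  have Esym: "E j i" if "E i j" for i j
    using that arcs_ends_symmetric[OF sym_arcs] by (auto simp: E_def)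
  have Eirr: "\<not> E i i" for i
    by (auto simp: E_def arcs_ends_conv dest: no_loops)
  have asym: "a i j = a j i" for i j
    using Esym by (auto simp: a_def edge_weight_def)
  have A: "adj_matrix_of G vs = mat n n (\<lambda>(i, j). a i j)"
    unfolding adj_matrix_of_def n(1) by (intro eq_matI) (auto simp: a_def edge_weight_def E_def)
  have cf: "clique_free E V (Suc (Suc k))"
    using K_free_imp_clique_free[OF assms(2) vs assms(4)] k
    unfolding E_def V_def n(1) by simp
  define lmax where "lmax = graph_eigenvalue 1 G"
  define lmin where "lmin = graph_eigenvalue n G"
  have ev1: "eigenvalue (mat n n (\<lambda>(i, j). a i j)) lmax"
    and evn: "\<And>l. eigenvalue (mat n n (\<lambda>(i, j). a i j)) l \<Longrightarrow> lmin \<le> l"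
    using graph_eigenvalues_extremal[OF assms(2,3) vs] by (simp_all only: A lmax_def lmin_def n_def)
  obtain x \<mu> where x: "(\<Sum>v\<in>V. (x v)\<^sup>2) = 1"
    "\<And>v. v \<in> V \<Longrightarrow> (\<Sum>u\<in>V. a v u * x u) = \<mu> * x v"
    "\<And>y. bil V a y y \<le> \<mu> * (\<Sum>v\<in>V. (y v)\<^sup>2)"
    using rayleigh_maximum[OF V(1,2), of a] asym by blast
  \<comment> \<open>An eigenvector for \<open>lmax\<close> is a test vector for the Rayleigh maximum
    \<mu>.\<close>
  have "lmax \<le> \<mu>"
  proof -
    obtain y i where y: "i < n" "y i \<noteq> 0" "\<And>i. i < n \<Longrightarrow> (\<Sum>j<n. a i j * y j) = lmax * y i"
      using ev1 unfolding eigenvalue_mat_iff by blast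
    have "bil V a y y = (\<Sum>i<n. y i * (lmax * y i))"
      unfolding bil_eq V_def by (intro sum.cong) (auto simp: y(3))
    also have "\<dots> = lmax * (\<Sum>v\<in>V. (y v)\<^sup>2)"
      by (simp add: V_def sum_distrib_left power2_eq_square mult_ac)
    finally have "lmax * (\<Sum>v\<in>V. (y v)\<^sup>2) \<le> \<mu> * (\<Sum>v\<in>V. (y v)\<^sup>2)"
      using x(3)[of y] by simp
    moreover have "(y i)\<^sup>2 \<le> (\<Sum>v\<in>V. (y v)\<^sup>2)"
      using y(1) V(1) by (intro member_le_sum) (auto simp: V_def)
    ultimately show ?thesis
      using y(2) by (smt (verit) mult_le_cancel_right zero_less_power2)
  qed
  \<comment> \<open>The Rayleigh maximum \<nu> of the negated form makes -\<nu> both an eigenvalue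
    and a lower bound of the form.\<close>
  have lower: "lmin * (\<Sum>v\<in>V. (y v)\<^sup>2) \<le> bil V a y y" for y
  proof -
    obtain z \<nu> where z: "(\<Sum>v\<in>V. (z v)\<^sup>2) = 1"
      "\<And>v. v \<in> V \<Longrightarrow> (\<Sum>u\<in>V. - a v u * z u) = \<nu> * z v"
      "\<And>y. bil V (\<lambda>u v. - a u v) y y \<le> \<nu> * (\<Sum>v\<in>V. (y v)\<^sup>2)"
      using rayleigh_maximum[OF V(1,2), of "\<lambda>u v. - a u v"] asym by auto
    have "\<exists>i<n. z i \<noteq> 0"
      using z(1) by (rule_tac ccontr) (simp add: V_def)
    moreover have "(\<Sum>j<n. a i j * z j) = - \<nu> * z i" if "i < n" for i
      using z(2)[of i] that by (simp add: V_def sum_negf)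
    ultimately have "eigenvalue (mat n n (\<lambda>(i, j). a i j)) (- \<nu>)"
      unfolding eigenvalue_mat_iff by blast
    then have "lmin \<le> - \<nu>" by (rule evn)
    then have "lmin * (\<Sum>v\<in>V. (y v)\<^sup>2) \<le> - \<nu> * (\<Sum>v\<in>V. (y v)\<^sup>2)"
      by (intro mult_right_mono sum_nonneg) auto
    also have "\<dots> \<le> bil V a y y"
      using z(3)[of y] by (simp add: bil_def sum_negf)
    finally show ?thesis .
  qed
  \<comment> \<open>The diagonal is zero, so the form vanishes at a coordinate vector.\<close>
  have "lmin \<le> 0"
  proof -
    have "(\<Sum>v\<in>V. (if v = 0 then 1 else 0 :: real)\<^sup>2) = (\<Sum>v\<in>V. if v = 0 then 1 else 0)"
      by (intro sum.cong) auto
    also have "\<dots> = 1" using n V(1) by (simp add: V_def)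
    finally have "(\<Sum>v\<in>V. (if v = 0 then 1 else 0 :: real)\<^sup>2) = 1" .
    moreover have "bil V a (\<lambda>v. if v = 0 then 1 else 0) (\<lambda>v. if v = 0 then 1 else 0) = 0"
      unfolding bil_def using Eirr by (intro sum.neutral ballI) (auto simp: a_def edge_weight_def)
    ultimately show ?thesis
      using lower[of "\<lambda>v. if v = 0 then 1 else 0"] by simp
  qed
  define B where "B = (2 * sqrt (1 - 1 / real r) - 1)\<^sup>2"
  have "lmax + lmin \<le> B * real n"
  proof (rule field_le_epsilon)
    fix \<epsilon> :: real
    assume "\<epsilon> > 0"
    \<comment> \<open>The slack \<epsilon> keeps \<open>L\<close> positive even when
      \<open>lmin\<close> is 0, as for a graph without edges.\<close>
    define L where "L = \<epsilon> - lmin"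
    have L: "L > 0" using \<open>\<epsilon> > 0\<close> \<open>lmin \<le> 0\<close> by (simp add: L_def)
    have psd: "bil V a y y + L * (\<Sum>v\<in>V. (y v)\<^sup>2) \<ge> 0" for y
    proof -
      have "\<epsilon> * (\<Sum>v\<in>V. (y v)\<^sup>2) \<ge> 0"
        using \<open>\<epsilon> > 0\<close> by (intro mult_nonneg_nonneg sum_nonneg) auto
      then show ?thesis using lower[of y] by (simp add: L_def left_diff_distrib)
    qed
    \<comment> \<open>For this \<open>t\<close> the tangent touches the curve exactly above n, so
      the linear bound collapses to \<mu> + L \<le> L * P after cancelling P + t * P'.\<close>
    obtain t where t: "t \<ge> 0" "t * geom (Suc k) t = n / L"
      using geom_Suc_surj[of "n / L" k] L by auto
    define P where "P = geom (Suc k) t"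
    define P' where "P' = dgeom (Suc k) t"
    have P: "P \<ge> 1" "P' \<ge> 0"
      using t geom_Suc_ge_1 dgeom_nonneg by (auto simp only: P_def P'_def)
    have nL: "real n = L * (t * P)"
      using t(2) L by (simp add: P_def field_simps)
    have "(P + t * P') * (\<mu> + L) \<le> P' * real n + P\<^sup>2 * L"
      unfolding P_def P'_def V(3)[symmetric]
      by (rule clique_free_spectral_bound[of L t E V, folded a_def, OF L t(1) _ Eirr V(1,2) cf psd x])
        (rule Esym)
    also have "\<dots> = (P + t * P') * (L * P)"
      unfolding nL by (simp add: power2_eq_square algebra_simps)
    finally have "\<mu> + L \<le> L * P"
      using P t(1) by (smt (verit) mult_le_cancel_left_pos mult_nonneg_nonneg)
    then have "\<mu> - L \<le> L * (P - 2)"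
      by (simp add: algebra_simps)
    also have "\<dots> \<le> L * (B * (t * P))"
      using geom_minus_2_le[OF t(1), of k] L
      by (intro mult_left_mono) (simp_all only: P_def B_def k less_imp_le)
    also have "\<dots> = B * real n"
      by (simp add: nL)
    finally show "lmax + lmin \<le> B * real n + \<epsilon>"
      using \<open>lmax \<le> \<mu>\<close> by (simp add: L_def)
  qed
  then show ?thesis
    using n by (simp add: B_def lmax_def lmin_def n_def divide_le_eq)
qed

end
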